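(* Let $\mu\preceq_{\mathrm{st}}\nu$ be Borel probability measures on $\mathbb{R}$ with cdf's $F_\mu,F_\nu$. The cdf $F_*(x,y)=P_*((-\infty,x]\times(-\infty,y])$ of $P_*=P_*(\mu,\nu)$ is given by $$F_*(x,y)=\begin{cases}F_\nu(y) & \text{if } y\le x,\\ F_\mu(x)-\inf_{z\in[x,y]}\big(F_\mu(z)-F_\nu(z)\big) & \text{if } y>x.\end{cases}$$
   Context: For finite Borel measures $\theta_1,\theta_2$ on $\mathbb{R}$ with cdf's $F_{\theta_i}(t)=\theta_i((-\infty,t])$, $\theta_1\preceq_{\mathrm{st}}\theta_2$ means $\theta_1(\mathbb{R})=\theta_2(\mathbb{R})$ and $F_{\theta_1}\ge F_{\theta_2}$; $\theta_1\le\theta_2$ means $\theta_1(A)\le\theta_2(A)$ for all Borel $A$. A directional coupling of $\mu,\nu$ is a probability measure on $\mathbb{R}^2$ with first marginal $\mu$ and second marginal $\nu$ concentrated on $\mathbb{H}=\{(x,y):y\ge x\}$. $P_*(\mu,\nu)$ denotes the optimal directional coupling: the unique directional coupling $P$ of $\mu,\nu$ such that $P((x,\infty)\times\cdot)=\nu_x$ for all $x\in\mathbb{R}$, where $\nu_x$ is the unique minimal element for $\preceq_{\mathrm{st}}$ of $\{\theta:\mu|_{(x,\infty)}\preceq_{\mathrm{st}}\theta\le\nu\}$ (equivalently, $F_{\nu_x}$ is the supremum of $F_\theta$ over this set). Existence and uniqueness hold whenever $\mu\preceq_{\mathrm{st}}\nu$. *)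

theory Defs
  imports "HOL-Probability.Probability"
begin

definition st_le :: "real measure \<Rightarrow> real measure \<Rightarrow> bool" (infix "\<preceq>\<^sub>s\<^sub>t" 50) where
  "\<theta>\<^sub>1 \<preceq>\<^sub>s\<^sub>t \<theta>\<^sub>2 \<longleftrightarrow> measure \<theta>\<^sub>1 UNIV = measure \<theta>\<^sub>2 UNIV \<and> (\<forall>t. cdf \<theta>\<^sub>2 t \<le> cdf \<theta>\<^sub>1 t)"

definition halfplane :: "(real \<times> real) set" where
  "halfplane = {(x, y). x \<le> y}"

definition directional_coupling ::
  "real measure \<Rightarrow> real measure \<Rightarrow> (real \<times> real) measure \<Rightarrow> bool" where
  "directional_coupling \<mu> \<nu> P \<longleftrightarrow>
     prob_space P \<and> sets P = sets borel \<and>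
     distr P borel fst = \<mu> \<and> distr P borel snd = \<nu> \<and>
     (AE z in P. z \<in> halfplane)"

(* The restriction is kept as a measure on all of the real line, A \<mapsto> \<mu> (A \<inter> {x<..});
   restrict_space would change the underlying space. *)
definition restrict_above :: "real measure \<Rightarrow> real \<Rightarrow> real measure" where
  "restrict_above \<mu> x = density \<mu> (indicator {x<..})"

(* For measures with equal sigma-algebras, as here, the library order \<le> on measures
   is the setwise order. *)
definition candidates :: "real measure \<Rightarrow> real measure \<Rightarrow> real \<Rightarrow> real measure set" where
  "candidates \<mu> \<nu> x =
     {\<theta>. finite_borel_measure \<theta> \<and> restrict_above \<mu> x \<preceq>\<^sub>s\<^sub>t \<theta> \<and> \<theta> \<le> \<nu>}"

definition st_minimal :: "real measure set \<Rightarrow> real measure \<Rightarrow> bool" where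
  "st_minimal S \<theta> \<longleftrightarrow> \<theta> \<in> S \<and> (\<forall>\<theta>'\<in>S. \<theta>' \<preceq>\<^sub>s\<^sub>t \<theta> \<longrightarrow> \<theta>' = \<theta>)"

definition nu_above :: "real measure \<Rightarrow> real measure \<Rightarrow> real \<Rightarrow> real measure" where
  "nu_above \<mu> \<nu> x = (THE \<theta>. st_minimal (candidates \<mu> \<nu> x) \<theta>)"

definition is_optimal_directional_coupling ::
  "real measure \<Rightarrow> real measure \<Rightarrow> (real \<times> real) measure \<Rightarrow> bool" where
  "is_optimal_directional_coupling \<mu> \<nu> P \<longleftrightarrow>
     directional_coupling \<mu> \<nu> P \<and>
     (\<forall>x. \<forall>B\<in>sets borel. emeasure P ({x<..} \<times> B) = emeasure (nu_above \<mu> \<nu> x) B)"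

definition optimal_directional_coupling ::
  "real measure \<Rightarrow> real measure \<Rightarrow> (real \<times> real) measure" where
  "optimal_directional_coupling \<mu> \<nu> = (THE P. is_optimal_directional_coupling \<mu> \<nu> P)"

definition joint_cdf :: "(real \<times> real) measure \<Rightarrow> real \<Rightarrow> real \<Rightarrow> real" where
  "joint_cdf P x y = measure P ({..x} \<times> {..y})"

end

theory Submission
  imports Defs
begin

text \<open>
Write \<open>F\<close> and \<open>G\<close> for the cdf's of \<open>\<mu>\<close> and \<open>\<nu>\<close>. If \<open>\<theta> \<le> \<nu>\<close> dominates the restriction of
\<open>\<mu>\<close> to \<open>(x, \<infinity>)\<close>, then splitting \<open>(-\<infinity>, y]\<close> at any \<open>z \<in> [x, y]\<close> and bounding the part below
\<open>z\<close> by stochastic order and the part above \<open>z\<close> by \<open>\<theta> \<le> \<nu>\<close> gives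
\<open>F\<^sub>\<theta> y \<le> (F z - F x) + (G y - G z)\<close>. Hence \<open>F\<^sub>\<theta>\<close> is bounded by
\<open>H\<^sub>x y = G y - F x + INF z\<in>{x..y}. F z - G z\<close> for \<open>y > x\<close>, and by \<open>0\<close> for \<open>y \<le> x\<close>. The whole
argument rests on the increments of \<open>H\<^sub>x\<close>: they are nonnegative, at most those of \<open>G\<close>, and
decreasing in \<open>x\<close>. By the first two properties \<open>H\<^sub>x\<close> is the cdf of a measure below \<open>\<nu>\<close>; it attains
the bound, so it is the least candidate and therefore the only minimal one
(\<open>st_minimal_iff\<close>). Once the optimal coupling \<open>P\<close> is known to exist, the formula is
\<open>P ((-\<infinity>, x] \<times> (-\<infinity>, y]) = G y - P ((x, \<infinity>) \<times> (-\<infinity>, y]) = G y - H\<^sub>x y\<close>.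

Existence of \<open>P\<close> uses the third property, which says that the measures \<open>\<nu>\<^sub>x\<close> decrease setwise in
\<open>x\<close>. As they also lie below \<open>\<nu>\<close>, their densities \<open>g\<^sub>x\<close> with respect to \<open>\<nu>\<close> decrease in \<open>x\<close> and
have values in \<open>[0, 1]\<close> up to null sets, so \<open>x \<mapsto> g\<^sub>x(y)\<close> is the survival function that the first coordinate ought to have given that the second
one is \<open>y\<close>. It is realised by inversion: draw \<open>(y, u)\<close> from the product of \<open>\<nu>\<close> and the uniform
distribution and take the supremum of the rational \<open>q\<close> with \<open>u < g\<^sub>q(y)\<close>
(\<open>coupling_from_decreasing_submeasures\<close>). The first marginal is \<open>\<mu>\<close> because \<open>\<nu>\<^sub>x\<close> has mass
\<open>1 - F x\<close>, and the coupling is directional because \<open>\<nu>\<^sub>x\<close> does not charge \<open>(-\<infinity>, x]\<close>.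
\<close>

section \<open>Comparison of measures\<close>

text \<open>The difference of the two cdf's is itself the cdf of a finite measure, and adding that measure
to \<open>\<alpha>\<close> gives \<open>\<beta>\<close>, by uniqueness on the half-lines.\<close>

lemma emeasure_mono_if_cdf_increments_le:
  fixes \<alpha> \<beta> :: "real measure"
  assumes "finite_borel_measure \<alpha>" and "finite_borel_measure \<beta>"
    and incr: "\<And>a b. a \<le> b \<Longrightarrow> cdf \<alpha> b - cdf \<alpha> a \<le> cdf \<beta> b - cdf \<beta> a"
    and B: "B \<in> sets borel"
  shows "emeasure \<alpha> B \<le> emeasure \<beta> B"
proof -
  interpret \<alpha>: finite_borel_measure \<alpha> by fact
  interpret \<beta>: finite_borel_measure \<beta> by fact
  define K where "K = (\<lambda>t. cdf \<beta> t - cdf \<alpha> t)"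
  define m where "m = measure \<beta> UNIV - measure \<alpha> UNIV"
  have K_mono: "K s \<le> K t" if "s \<le> t" for s t
    using incr[OF that] by (simp add: K_def)
  have K_right: "continuous (at_right a) K" for a
    unfolding K_def by (intro continuous_diff \<alpha>.cdf_is_right_cont \<beta>.cdf_is_right_cont)
  have K_bot: "(K \<longlongrightarrow> 0) at_bot"
    unfolding K_def using tendsto_diff[OF \<beta>.cdf_lim_at_bot \<alpha>.cdf_lim_at_bot] by simp
  have K_top: "(K \<longlongrightarrow> m) at_top"
    unfolding K_def m_def
    using tendsto_diff[OF \<beta>.cdf_lim_at_top \<alpha>.cdf_lim_at_top] \<alpha>.borel_UNIV \<beta>.borel_UNIV by simp
  have K_nonneg: "0 \<le> K t" for t
    using K_bot by (rule tendsto_upperbound)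
      (auto simp: eventually_at_bot_linorder K_mono intro!: exI[of _ t])
  have m: "0 \<le> m"
    using K_top by (rule tendsto_lowerbound) (auto simp: K_nonneg)
  define \<kappa> where "\<kappa> = interval_measure K"
  interpret \<kappa>: finite_borel_measure \<kappa>
    unfolding \<kappa>_def by (rule finite_borel_measure_interval_measure[OF K_mono K_right K_bot K_top m])
  have \<kappa>_UNIV: "measure \<kappa> UNIV = m"
    unfolding \<kappa>_def using interval_measure_UNIV[OF K_mono K_right K_bot K_top m] m
    by (simp add: measure_def)
  have borel_eq: "sets borel = sigma_sets UNIV (range (\<lambda>a::real. {..a}))"
    by (subst borel_eq_atMost) simp
  have "measure \<beta> B = measure \<alpha> B + measure \<kappa> B"
    using B unfolding borel_eq
  proof (rule sigma_sets_induct_disjoint[rotated 2])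
    show "Int_stable (range (\<lambda>a::real. {..a}))"
      by (auto simp: Int_stable_def)
    show "range (\<lambda>a::real. {..a}) \<subseteq> Pow UNIV" by simp
    fix A :: "real set" assume "A \<in> range (\<lambda>a. {..a})"
    then obtain a where A: "A = {..a}" by auto
    have "measure \<kappa> {..a} = K a"
      unfolding \<kappa>_def by (rule measure_interval_measure_Iic[OF K_mono K_right K_bot])
    then show "measure \<beta> A = measure \<alpha> A + measure \<kappa> A"
      by (simp add: A K_def cdf_def)
  next
    show "measure \<beta> {} = measure \<alpha> {} + measure \<kappa> {}" by simp
  next
    fix A :: "real set"
    assume A: "A \<in> sigma_sets UNIV (range (\<lambda>a. {..a}))"
      and eq: "measure \<beta> A = measure \<alpha> A + measure \<kappa> A"
    have A: "A \<in> sets borel" using A by (simp only: borel_eq)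
    show "measure \<beta> (UNIV - A) = measure \<alpha> (UNIV - A) + measure \<kappa> (UNIV - A)"
      using \<alpha>.finite_measure_compl[of A] \<beta>.finite_measure_compl[of A] \<kappa>.finite_measure_compl[of A]
        A eq \<kappa>_UNIV
      by (simp add: \<alpha>.sets_M \<beta>.sets_M \<kappa>.sets_M \<alpha>.borel_UNIV \<beta>.borel_UNIV \<kappa>.borel_UNIV m_def)
  next
    fix A :: "nat \<Rightarrow> real set"
    assume disj: "disjoint_family A" and "range A \<subseteq> sigma_sets UNIV (range (\<lambda>a. {..a}))"
      and eq: "\<And>i. measure \<beta> (A i) = measure \<alpha> (A i) + measure \<kappa> (A i)"
    then have A: "range A \<subseteq> sets borel" by (simp only: borel_eq)
    have "(\<lambda>i. measure \<beta> (A i)) sums (measure \<alpha> (\<Union>i. A i) + measure \<kappa> (\<Union>i. A i))"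
      unfolding eq using A disj \<alpha>.M_is_borel \<kappa>.M_is_borel
      by (intro sums_add \<alpha>.finite_measure_UNION \<kappa>.finite_measure_UNION) auto
    moreover have "(\<lambda>i. measure \<beta> (A i)) sums measure \<beta> (\<Union>i. A i)"
      using A disj \<beta>.M_is_borel by (intro \<beta>.finite_measure_UNION) auto
    ultimately show "measure \<beta> (\<Union>i. A i) = measure \<alpha> (\<Union>i. A i) + measure \<kappa> (\<Union>i. A i)"
      by (metis sums_unique2)
  qed
  then show ?thesis
    by (simp add: \<alpha>.emeasure_eq_measure \<beta>.emeasure_eq_measure ennreal_leI)
qed

text \<open>The pointwise maximum of \<open>f\<close> and \<open>g\<close> has the same density measure as \<open>g\<close>: on the set where
\<open>f\<close> is the larger function, the hypothesis bounds the integral of \<open>f\<close> by that of \<open>g\<close>. Uniqueness of densities does the rest.\<close>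

lemma AE_le_if_density_le:
  assumes "sigma_finite_measure M"
    and [measurable]: "f \<in> borel_measurable M" "g \<in> borel_measurable M"
    and le: "\<And>A. A \<in> sets M \<Longrightarrow> emeasure (density M f) A \<le> emeasure (density M g) A"
  shows "AE x in M. f x \<le> g x"
proof -
  interpret sigma_finite_measure M by fact
  have "density M (\<lambda>x. max (f x) (g x)) = density M g"
  proof (rule measure_eqI)
    fix A assume "A \<in> sets (density M (\<lambda>x. max (f x) (g x)))"
    then have A[measurable]: "A \<in> sets M" by simp
    define S where "S = {x\<in>space M. g x < f x}"
    have S[measurable]: "S \<in> sets M" unfolding S_def by measurable
    have "emeasure (density M (\<lambda>x. max (f x) (g x))) A
        = (\<integral>\<^sup>+x. f x * indicator (A \<inter> S) x + g x * indicator (A - S) x \<partial>M)"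
      by (subst emeasure_density, simp_all, intro nn_integral_cong)
         (auto simp: S_def indicator_def max_def)
    also have "\<dots> = emeasure (density M f) (A \<inter> S) + emeasure (density M g) (A - S)"
      by (simp add: nn_integral_add emeasure_density)
    also have "\<dots> \<le> emeasure (density M g) (A \<inter> S) + emeasure (density M g) (A - S)"
      by (intro add_right_mono le) simp
    also have "\<dots> = emeasure (density M g) ((A \<inter> S) \<union> (A - S))"
      by (rule plus_emeasure) auto
    also have "(A \<inter> S) \<union> (A - S) = A" by auto
    finally have "emeasure (density M (\<lambda>x. max (f x) (g x))) A \<le> emeasure (density M g) A" .
    moreover have "emeasure (density M g) A \<le> emeasure (density M (\<lambda>x. max (f x) (g x))) A"
      by (simp add: emeasure_density) (auto intro!: nn_integral_mono mult_right_mono)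
    ultimately show "emeasure (density M (\<lambda>x. max (f x) (g x))) A = emeasure (density M g) A"
      by (rule antisym)
  qed simp
  then have "AE x in M. max (f x) (g x) = g x"
    by (subst (asm) density_unique_iff) auto
  then show ?thesis by eventually_elim (metis max.cobounded1)
qed

text \<open>The quadrants form an intersection-stable generator of the Borel sets of the plane. It serves
for the uniqueness of the optimal coupling, whose values on quadrants are prescribed.\<close>

lemma measure_eqI_upper_quadrants:
  fixes P Q :: "(real \<times> real) measure"
  assumes "prob_space P" and sets: "sets P = sets borel" "sets Q = sets borel"
    and eq: "\<And>x y. emeasure P ({x<..} \<times> {y<..}) = emeasure Q ({x<..} \<times> {y<..})"
  shows "P = Q"
proof (rule measure_eqI_generator_eq)
  interpret P: prob_space P by fact
  let ?E = "{a \<times> b | a b. a \<in> range (greaterThan :: real \<Rightarrow> _) \<and> b \<in> range (greaterThan :: real \<Rightarrow> _)}"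
  have cover: "(\<Union>n. {- real n<..}) = (UNIV :: real set)"
    using UN_Ioc_eq_UNIV by (auto simp: set_eq_iff)
  have cover': "\<exists>C\<subseteq>range greaterThan. countable C \<and> (UNIV :: real set) = \<Union>C"
    using cover by (intro exI[of _ "range (\<lambda>n. {- real n<..})"]) auto
  have "(borel :: (real \<times> real) measure) = sigma UNIV (range greaterThan) \<Otimes>\<^sub>M sigma UNIV (range greaterThan)"
    by (simp add: borel_prod flip: borel_Ioi)
  also have "\<dots> = sigma (UNIV \<times> UNIV) ?E"
    by (rule sigma_prod[OF cover' _ cover']) auto
  finally have "sets (borel :: (real \<times> real) measure) = sets (sigma UNIV ?E)" by simp
  then have borel: "sets (borel :: (real \<times> real) measure) = sigma_sets UNIV ?E"
    by (simp add: sets_measure_of)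
  show "sets P = sigma_sets UNIV ?E" "sets Q = sigma_sets UNIV ?E"
    using sets borel by simp_all
  show "Int_stable ?E"
    unfolding Int_stable_def
  proof (intro ballI)
    fix a b assume "a \<in> ?E" "b \<in> ?E"
    then obtain x y x' y' where "a = {x<..} \<times> {y<..}" "b = {x'<..} \<times> {y'<..}" by auto
    then have "a \<inter> b = {max x x'<..} \<times> {max y y'<..}" by auto
    then show "a \<inter> b \<in> ?E" by blast
  qed
  show "?E \<subseteq> Pow UNIV" by simp
  show "emeasure P X = emeasure Q X" if "X \<in> ?E" for X
    using that eq by auto
  show "range (\<lambda>n. {- real n<..} \<times> {- real n<..}) \<subseteq> ?E" by auto
  show "(\<Union>n. {- real n<..} \<times> {- real n<..}) = (UNIV :: (real \<times> real) set)"
  proof (intro equalityI subsetI UNIV_I)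
    fix w :: "real \<times> real"
    obtain n where "max (- fst w) (- snd w) < real n" using reals_Archimedean2 by blast
    then have "w \<in> {- real n<..} \<times> {- real n<..}" by (cases w) auto
    then show "w \<in> (\<Union>n. {- real n<..} \<times> {- real n<..})" by blast
  qed
  show "emeasure P ({- real n<..} \<times> {- real n<..}) \<noteq> \<infinity>" for n by simp
qed

section \<open>Couplings from decreasing families of submeasures\<close>

text \<open>A coupling is determined by the measures \<open>\<theta> x\<close> that it puts on the strips \<open>(x, \<infinity>) \<times> B\<close>. Right
continuity in \<open>x\<close> is needed of such a family, but only the total masses are asked to have it: for a
setwise monotone family the convergence of the masses forces the convergence on every set.\<close>

lemma coupling_from_decreasing_submeasures:
  fixes \<mu> \<nu> :: "real measure" and \<theta> :: "real \<Rightarrow> real measure"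
  assumes "real_distribution \<mu>" and "real_distribution \<nu>"
    and sets_\<theta>: "\<And>x. sets (\<theta> x) = sets borel"
    and le: "\<And>x B. B \<in> sets borel \<Longrightarrow> emeasure (\<theta> x) B \<le> emeasure \<nu> B"
    and antimono: "\<And>x x' B. x \<le> x' \<Longrightarrow> B \<in> sets borel \<Longrightarrow> emeasure (\<theta> x') B \<le> emeasure (\<theta> x) B"
    and mass: "\<And>x. emeasure (\<theta> x) UNIV = ennreal (1 - cdf \<mu> x)"
  obtains P :: "(real \<times> real) measure"
  where "prob_space P" and "sets P = sets borel" and "distr P borel snd = \<nu>"
    and "\<And>x B. B \<in> sets borel \<Longrightarrow> emeasure P ({x<..} \<times> B) = emeasure (\<theta> x) B"
proof -
  interpret \<mu>: real_distribution \<mu> by fact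
  interpret \<nu>: real_distribution \<nu> by fact
  define U where "U = uniform_measure lborel {0<..<1::real}"
  interpret U: prob_space U
    unfolding U_def by (rule prob_space_uniform_measure) simp_all
  have sets_U[measurable_cong]: "sets U = sets borel" by (simp add: U_def)
  interpret N: pair_prob_space \<nu> U ..
  let ?N = "\<nu> \<Otimes>\<^sub>M U"
  have space_U: "space U = UNIV" using sets_eq_imp_space_eq[OF sets_U] by simp
  have space_N: "space ?N = UNIV" by (simp add: space_pair_measure space_U)

  have strip[measurable]: "B \<times> UNIV \<in> sets ?N" if "B \<in> sets borel" for B
    using that by (intro pair_measureI) (simp_all add: sets_U)

  have "\<exists>f\<in>borel_measurable \<nu>. density \<nu> f = \<theta> x" for x
  proof (rule \<nu>.Radon_Nikodym)
    show "absolutely_continuous \<nu> (\<theta> x)"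
      unfolding absolutely_continuous_def null_sets_def
      using le[of _ x] sets_\<theta>[of x] by (auto, metis le_zero_eq)
  qed (simp add: sets_\<theta>)
  then obtain g where g_meas: "\<And>x. g x \<in> borel_measurable \<nu>" and g: "\<And>x. density \<nu> (g x) = \<theta> x"
    by metis
  have g_meas'[measurable]: "g x \<in> borel_measurable borel" for x
    using g_meas[of x] measurable_cong_sets[OF \<nu>.events_eq_borel refl] by blast
  have g_le_1: "AE y in \<nu>. g x y \<le> 1" for x
    by (rule AE_le_if_density_le) (auto simp: g density_1 le \<nu>.sigma_finite_measure_axioms)
  have g_antimono: "AE y in \<nu>. g x' y \<le> g x y" if "x \<le> x'" for x x'
    by (rule AE_le_if_density_le) (auto simp: g antimono that \<nu>.sigma_finite_measure_axioms)

  \<comment> \<open>The subgraphs of the densities encode all the measures \<open>\<theta> x\<close> in the single space \<open>\<nu> \<Otimes> U\<close>.\<close>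
  define A where "A x = {w. ennreal (snd w) < g x (fst w)}" for x
  have A_sets[measurable]: "A x \<in> sets ?N" for x
  proof -
    have "{w \<in> space ?N. ennreal (snd w) < g x (fst w)} \<in> sets ?N" by measurable
    then show ?thesis by (simp add: A_def space_N)
  qed
  have emeasure_A: "emeasure ?N (A x \<inter> (B \<times> UNIV)) = emeasure (\<theta> x) B"
    if [measurable]: "B \<in> sets borel" for x B
  proof -
    have slice: "emeasure U {u. ennreal u < c} = c" if "c \<le> 1" for c
    proof -
      obtain r where r: "c = ennreal r" "0 \<le> r" "r \<le> 1"
        using \<open>c \<le> 1\<close> by (cases c) (auto simp: top_unique)
      have "{u. ennreal u < c} \<in> sets lborel" by measurable
      then have "emeasure U {u. ennreal u < c} = emeasure lborel ({0<..<1} \<inter> {u. ennreal u < c})"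
        unfolding U_def by (subst emeasure_uniform_measure) (auto simp: divide_ennreal_def)
      also have "{0<..<1} \<inter> {u. ennreal u < c} = {0<..<r}"
        using r by (auto simp: ennreal_less_iff)
      finally show ?thesis using r by simp
    qed
    have "emeasure ?N (A x \<inter> (B \<times> UNIV))
        = (\<integral>\<^sup>+y. emeasure U (Pair y -` (A x \<inter> (B \<times> UNIV))) \<partial>\<nu>)"
      by (rule U.emeasure_pair_measure_alt) measurable
    also have "\<dots> = (\<integral>\<^sup>+y. g x y * indicator B y \<partial>\<nu>)"
    proof (rule nn_integral_cong_AE)
      show "AE y in \<nu>. emeasure U (Pair y -` (A x \<inter> (B \<times> UNIV))) = g x y * indicator B y"
        using g_le_1[of x]
      proof eventually_elim
        fix y assume "g x y \<le> 1"
        then show "emeasure U (Pair y -` (A x \<inter> (B \<times> UNIV))) = g x y * indicator B y"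
          using slice[of "g x y"]
          by (cases "y \<in> B") (auto simp: A_def vimage_def)
      qed
    qed
    also have "\<dots> = emeasure (density \<nu> (g x)) B"
      by (subst emeasure_density) (auto simp: g_meas)
    finally show ?thesis by (simp add: g)
  qed

  \<comment> \<open>The values are extended reals because the set of admissible \<open>q\<close> may be empty or unbounded on a
    null set; the supremum runs over the rationals to keep it measurable.\<close>
  define T where "T w = (SUP q\<in>\<rat>. if w \<in> A q then ereal q else -\<infinity>)" for w
  have T_meas[measurable]: "T \<in> borel_measurable ?N"
    unfolding T_def by (intro borel_measurable_SUP countable_rat) measurable
  define E where "E x = {w. ereal x < T w}" for x
  have E_sets[measurable]: "E x \<in> sets ?N" for x
  proof -
    have "{w \<in> space ?N. ereal x < T w} \<in> sets ?N" by measurable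
    then show ?thesis by (simp add: E_def space_N)
  qed
  have E_eq: "E x = (\<Union>q\<in>{q\<in>\<rat>. x < q}. A q)" for x
    unfolding E_def T_def less_SUP_iff by (fastforce split: if_splits)
  have E_subset_A: "AE w in ?N. w \<in> E x \<longrightarrow> w \<in> A x" for x
  proof -
    have "AE y in \<nu>. \<forall>q\<in>{q\<in>\<rat>. x < q}. g q y \<le> g x y"
      using g_antimono by (subst AE_ball_countable) (auto intro: countable_subset[OF _ countable_rat])
    then have "AE y in distr ?N \<nu> fst. \<forall>q\<in>{q\<in>\<rat>. x < q}. g q y \<le> g x y"
      by (subst U.distr_pair_fst)
    then have "AE w in ?N. \<forall>q\<in>{q\<in>\<rat>. x < q}. g q (fst w) \<le> g x (fst w)"
      by (rule AE_distrD[OF measurable_fst])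
    then show ?thesis
      by eventually_elim (auto simp: E_eq A_def intro: less_le_trans)
  qed
  have E_le: "emeasure ?N (E x \<inter> (B \<times> UNIV)) \<le> emeasure (\<theta> x) B"
    if [measurable]: "B \<in> sets borel" for x B
  proof -
    have "emeasure ?N (E x \<inter> (B \<times> UNIV)) \<le> emeasure ?N (A x \<inter> (B \<times> UNIV))"
      using E_subset_A[of x] A_sets[of x] strip[OF that] by (intro emeasure_mono_AE) auto
    then show ?thesis by (simp add: emeasure_A)
  qed
  \<comment> \<open>Right continuity of the masses enters here: \<open>E x\<close> only contains the subgraphs with \<open>q > x\<close>.\<close>
  have E_mass: "emeasure ?N (E x) = ennreal (1 - cdf \<mu> x)" for x
  proof (rule antisym)
    show "emeasure ?N (E x) \<le> ennreal (1 - cdf \<mu> x)"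
      using E_le[of UNIV x] by (simp add: mass)
    have "1 - cdf \<mu> q \<le> measure ?N (E x)" if "q \<in> \<rat>" "x < q" for q
    proof -
      have "ennreal (1 - cdf \<mu> q) = emeasure ?N (A q)"
        using emeasure_A[of UNIV q] by (simp add: mass)
      also have "\<dots> \<le> emeasure ?N (E x)"
        using that E_sets[of x] by (intro emeasure_mono) (auto simp: E_eq)
      finally show ?thesis by (simp add: N.emeasure_eq_measure)
    qed
    note rational = this
    have "1 - cdf \<mu> z \<le> measure ?N (E x)" if "x < z" for z
    proof -
      obtain q where "q \<in> \<rat>" "x < q" "q < z" using Rats_dense_in_real \<open>x < z\<close> by blast
      then show ?thesis using rational[of q] \<mu>.cdf_nondecreasing[of q z] by simp
    qed
    moreover have "((\<lambda>z. 1 - cdf \<mu> z) \<longlongrightarrow> 1 - cdf \<mu> x) (at_right x)"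
      using \<mu>.cdf_is_right_cont[of x] by (intro tendsto_intros) (simp add: continuous_within)
    ultimately have "1 - cdf \<mu> x \<le> measure ?N (E x)"
      by (intro tendsto_upperbound[where F="at_right x" and f="\<lambda>z. 1 - cdf \<mu> z"])
         (auto simp: eventually_at_filter)
    then show "ennreal (1 - cdf \<mu> x) \<le> emeasure ?N (E x)"
      by (simp add: N.emeasure_eq_measure ennreal_leI)
  qed
  \<comment> \<open>The bound \<open>E_le\<close> holds for \<open>B\<close> and for its complement, and both bounds add up to the total
    mass of \<open>E x\<close>, so neither of them can be strict.\<close>
  have E_rect: "emeasure ?N (E x \<inter> (B \<times> UNIV)) = emeasure (\<theta> x) B"
    if [measurable]: "B \<in> sets borel" for x B
  proof (rule antisym)
    have fin: "emeasure (\<theta> x) C \<noteq> \<infinity>" if "C \<in> sets borel" for C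
      using le[OF that, of x] \<nu>.emeasure_finite[of C] by (auto simp: top_unique)
    have "emeasure (\<theta> x) B + emeasure (\<theta> x) (- B) = emeasure (\<theta> x) UNIV"
      using that by (subst plus_emeasure) (auto simp: sets_\<theta>)
    also have "\<dots> = emeasure ?N (E x)" by (simp add: mass E_mass)
    also have "\<dots> = emeasure ?N ((E x \<inter> (B \<times> UNIV)) \<union> (E x \<inter> ((- B) \<times> UNIV)))"
      by (rule arg_cong[where f="emeasure ?N"]) auto
    also have "\<dots> = emeasure ?N (E x \<inter> (B \<times> UNIV)) + emeasure ?N (E x \<inter> ((- B) \<times> UNIV))"
      using that by (intro plus_emeasure[symmetric] sets.Int[OF E_sets strip]) auto
    also have "\<dots> \<le> emeasure ?N (E x \<inter> (B \<times> UNIV)) + emeasure (\<theta> x) (- B)"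
      by (intro add_left_mono E_le) measurable
    finally show "emeasure (\<theta> x) B \<le> emeasure ?N (E x \<inter> (B \<times> UNIV))"
      using fin[of "- B"] that
      by (simp add: ennreal_add_left_cancel_le add.commute[of _ "emeasure (\<theta> x) (- B)"])
  qed (rule E_le[OF that])

  have T_finite: "AE w in ?N. \<bar>T w\<bar> \<noteq> \<infinity>"
  proof -
    have cdf_top: "(\<lambda>n. cdf \<mu> (real n)) \<longlonglongrightarrow> 1" by (rule \<mu>.cdf_lim_infty_prob)
    have E_meas: "measure ?N (E x) = 1 - cdf \<mu> x" for x
      using E_mass[of x] \<mu>.cdf_bounded_prob[of x] by (simp add: measure_def)
    have top: "AE w in ?N. T w \<noteq> \<infinity>"
    proof -
      let ?S = "{w. T w = \<infinity>}"
      have S: "?S \<in> sets ?N"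
      proof -
        have "{w \<in> space ?N. T w = \<infinity>} \<in> sets ?N" by measurable
        then show ?thesis by (simp add: space_N)
      qed
      have "measure ?N ?S \<le> 1 - cdf \<mu> (real n)" for n
        unfolding E_meas[symmetric] by (intro N.finite_measure_mono E_sets) (auto simp: E_def)
      moreover have "(\<lambda>n. 1 - cdf \<mu> (real n)) \<longlonglongrightarrow> 1 - 1" by (intro tendsto_intros cdf_top)
      ultimately have "measure ?N ?S \<le> 0"
        using LIMSEQ_le_const[of "\<lambda>n. 1 - cdf \<mu> (real n)" "1 - 1" "measure ?N ?S"] by auto
      then have "measure ?N ?S = 0" using measure_nonneg[of ?N ?S] by linarith
      then show ?thesis
        by (intro AE_I[where N="?S"] S) (auto simp: N.emeasure_eq_measure)
    qed
    have bot: "AE w in ?N. T w \<noteq> -\<infinity>"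
    proof -
      let ?S = "{w. T w = -\<infinity>}"
      have S: "?S \<in> sets ?N"
      proof -
        have "{w \<in> space ?N. T w = -\<infinity>} \<in> sets ?N" by measurable
        then show ?thesis by (simp add: space_N)
      qed
      have "measure ?N ?S \<le> cdf \<mu> (- real n)" for n
      proof -
        have "measure ?N ?S \<le> measure ?N (space ?N - E (- real n))"
          by (intro N.finite_measure_mono sets.compl_sets E_sets) (auto simp: E_def space_N)
        also have "\<dots> = cdf \<mu> (- real n)"
          by (subst N.prob_compl[OF E_sets]) (simp add: E_meas)
        finally show ?thesis .
      qed
      then have "measure ?N ?S \<le> 0"
        using LIMSEQ_le_const[OF \<mu>.cdf_lim_neg_infty] by auto
      then have "measure ?N ?S = 0" using measure_nonneg[of ?N ?S] by linarith
      then show ?thesis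
        by (intro AE_I[where N="?S"] S) (auto simp: N.emeasure_eq_measure)
    qed
    show ?thesis using top bot by eventually_elim auto
  qed

  define h where "h w = (real_of_ereal (T w), fst w)" for w
  have h_meas: "h \<in> measurable ?N borel"
    unfolding h_def borel_prod[symmetric] by measurable
  define P where "P = distr ?N borel h"
  show thesis
  proof (rule that[of P])
    show "prob_space P"
      unfolding P_def by (rule N.prob_space_distr[OF h_meas])
    show "sets P = sets borel" by (simp add: P_def)
    have "distr P borel snd = distr ?N borel (snd \<circ> h)"
      unfolding P_def by (rule distr_distr[OF _ h_meas]) (auto simp: borel_prod[symmetric])
    also have "snd \<circ> h = fst" by (auto simp: h_def)
    also have "distr ?N borel fst = distr ?N \<nu> fst"
      by (rule distr_cong) simp_all
    also have "\<dots> = \<nu>" by (rule U.distr_pair_fst)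
    finally show "distr P borel snd = \<nu>" .
    fix x :: real and B :: "real set" assume B[measurable]: "B \<in> sets borel"
    have "{x<..} \<times> B \<in> sets (borel :: (real \<times> real) measure)"
      unfolding borel_prod[symmetric] by measurable
    then have preimage: "h -` ({x<..} \<times> B) \<inter> space ?N \<in> sets ?N"
      and "emeasure P ({x<..} \<times> B) = emeasure ?N (h -` ({x<..} \<times> B) \<inter> space ?N)"
      unfolding P_def by (rule measurable_sets[OF h_meas], rule emeasure_distr[OF h_meas])
    note this(2)
    also have "emeasure ?N (h -` ({x<..} \<times> B) \<inter> space ?N) = emeasure ?N (E x \<inter> (B \<times> UNIV))"
    proof (rule emeasure_eq_AE)
      show "AE w in ?N. w \<in> h -` ({x<..} \<times> B) \<inter> space ?N \<longleftrightarrow> w \<in> E x \<inter> (B \<times> UNIV)"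
        using T_finite
      proof eventually_elim
        fix w assume "\<bar>T w\<bar> \<noteq> \<infinity>"
        then obtain r where "T w = ereal r" by auto
        then show "w \<in> h -` ({x<..} \<times> B) \<inter> space ?N \<longleftrightarrow> w \<in> E x \<inter> (B \<times> UNIV)"
          by (cases w) (simp add: h_def E_def space_N)
      qed
    qed (rule preimage, rule sets.Int[OF E_sets strip[OF B]])
    also have "\<dots> = emeasure (\<theta> x) B" by (rule E_rect[OF B])
    finally show "emeasure P ({x<..} \<times> B) = emeasure (\<theta> x) B" .
  qed
qed

section \<open>The least candidate\<close>

locale st_ordered = \<mu>: real_distribution \<mu> + \<nu>: real_distribution \<nu>
  for \<mu> \<nu> :: "real measure" +
  assumes st_le: "\<mu> \<preceq>\<^sub>s\<^sub>t \<nu>"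
begin

definition gap :: "real \<Rightarrow> real" where
  "gap z = cdf \<mu> z - cdf \<nu> z"

definition min_gap :: "real \<Rightarrow> real \<Rightarrow> real" where
  "min_gap x y = (INF z\<in>{x..y}. gap z)"

text \<open>The largest cdf that a candidate can have.\<close>

definition cdf_above :: "real \<Rightarrow> real \<Rightarrow> real" where
  "cdf_above x y = (if y \<le> x then 0 else cdf \<nu> y - cdf \<mu> x + min_gap x y)"

lemma gap_nonneg: "0 \<le> gap z"
  using st_le by (simp add: gap_def st_le_def)

lemma bdd_below_gap: "bdd_below (gap ` S)"
  by (rule bdd_belowI[of _ 0]) (auto simp: gap_nonneg)

lemma min_gap_le: "x \<le> z \<Longrightarrow> z \<le> y \<Longrightarrow> min_gap x y \<le> gap z"
  unfolding min_gap_def by (rule cINF_lower) (auto intro: bdd_below_gap)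

lemma min_gap_greatest:
  assumes "x \<le> y" and "\<And>z. x \<le> z \<Longrightarrow> z \<le> y \<Longrightarrow> c \<le> gap z"
  shows "c \<le> min_gap x y"
  unfolding min_gap_def using assms by (intro cINF_greatest) auto

lemma min_gap_split:
  assumes "x \<le> a" and "a \<le> b"
  shows "min_gap x b = min (min_gap x a) (min_gap a b)"
proof -
  have "{x..b} = {x..a} \<union> {a..b}" using assms by auto
  then show ?thesis
    using assms by (simp add: min_gap_def cINF_union bdd_below_gap inf_min)
qed

text \<open>At \<open>y = x\<close> the second branch of the definition also vanishes, which lets the case \<open>y = x\<close> be
treated together with \<open>y > x\<close> below.\<close>

lemma cdf_above_eq:
  assumes "x \<le> y"
  shows "cdf_above x y = cdf \<nu> y - cdf \<mu> x + min_gap x y"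
  using assms by (auto simp: cdf_above_def min_gap_def gap_def)

text \<open>Extending the range of the infimum from \<open>[x, a]\<close> to \<open>[x, b]\<close> lowers it by the amount by which
the infimum over \<open>[a, b]\<close> falls short of it. This makes the dependence on \<open>x\<close> visible.\<close>

lemma cdf_above_increment:
  assumes "x \<le> a" and "a \<le> b"
  shows "cdf_above x b - cdf_above x a
    = cdf \<nu> b - cdf \<nu> a + min 0 (min_gap a b - min_gap x a)"
  using assms by (simp add: cdf_above_eq min_gap_split[OF assms] min_def)

lemma cdf_above_increment_le:
  assumes "a \<le> b"
  shows "cdf_above x b - cdf_above x a \<le> cdf \<nu> b - cdf \<nu> a"
proof (cases "x \<le> a")
  case True
  then show ?thesis using cdf_above_increment[OF True assms] by simp
next
  case False
  then have a: "cdf_above x a = 0" by (simp add: cdf_above_def)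
  show ?thesis
  proof (cases "x \<le> b")
    case True
    have "cdf_above x b - cdf_above x x \<le> cdf \<nu> b - cdf \<nu> x"
      using cdf_above_increment[OF order_refl True] by simp
    then show ?thesis
      using a False \<nu>.cdf_nondecreasing[of a x] by (simp add: cdf_above_def)
  next
    case False
    then show ?thesis using a \<nu>.cdf_nondecreasing[OF assms] by (simp add: cdf_above_def)
  qed
qed

text \<open>The infimum can fall by at most the growth of the cdf of \<open>\<nu>\<close>, since the cdf of \<open>\<mu>\<close> does not
decrease.\<close>

lemma cdf_above_mono:
  assumes "a \<le> b"
  shows "cdf_above x a \<le> cdf_above x b"
proof -
  have right: "cdf_above x a' \<le> cdf_above x b" if "x \<le> a'" "a' \<le> b" for a'
  proof -
    have "min_gap x a' - (cdf \<nu> b - cdf \<nu> a') \<le> min_gap a' b"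
    proof (rule min_gap_greatest[OF \<open>a' \<le> b\<close>])
      fix z assume z: "a' \<le> z" "z \<le> b"
      have "min_gap x a' \<le> gap a'" using that by (intro min_gap_le) auto
      then show "min_gap x a' - (cdf \<nu> b - cdf \<nu> a') \<le> gap z"
        using \<mu>.cdf_nondecreasing[OF z(1)] \<nu>.cdf_nondecreasing[OF z(2)] by (simp add: gap_def)
    qed
    then show ?thesis
      using cdf_above_increment[OF that] \<nu>.cdf_nondecreasing[OF that(2)] by (simp add: min_def split: if_splits)
  qed
  show ?thesis
  proof (cases "x \<le> a")
    case True
    then show ?thesis using right assms by simp
  next
    case False
    then have "cdf_above x a = 0" by (simp add: cdf_above_def)
    moreover have "0 \<le> cdf_above x b"
      using right[of x] by (cases "x \<le> b") (auto simp: cdf_above_def)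
    ultimately show ?thesis by simp
  qed
qed

text \<open>A larger \<open>x\<close> means an infimum over a smaller interval \<open>[x, a]\<close>, hence a larger drop when \<open>[a, b]\<close>
is added. This monotonicity is what makes the least candidates for different \<open>x\<close> fit together into
one coupling.\<close>

lemma cdf_above_increment_antimono:
  assumes "x \<le> x'" and "a \<le> b"
  shows "cdf_above x' b - cdf_above x' a \<le> cdf_above x b - cdf_above x a"
proof -
  have right: "cdf_above x' b - cdf_above x' a' \<le> cdf_above x b - cdf_above x a'"
    if "x' \<le> a'" "a' \<le> b" for a'
  proof -
    have "min_gap x a' \<le> min_gap x' a'"
      using min_gap_split[OF assms(1) that(1)] by simp
    then show ?thesis
      using that assms by (simp add: cdf_above_increment)
  qed
  show ?thesis
  proof (cases "x' \<le> a")
    case True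
    then show ?thesis using right assms by simp
  next
    case False
    then have a: "cdf_above x' a = 0" by (simp add: cdf_above_def)
    show ?thesis
    proof (cases "x' \<le> b")
      case True
      have "cdf_above x' b \<le> cdf_above x b - cdf_above x x'"
        using right[of x'] True by (simp add: cdf_above_def)
      then show ?thesis using a False cdf_above_mono[of a x' x] by simp
    next
      case False
      then show ?thesis using a cdf_above_mono[OF assms(2), of x] by (simp add: cdf_above_def)
    qed
  qed
qed

text \<open>Right continuity is inherited from the cdf of \<open>\<nu>\<close> through the bound on the increments.\<close>

lemma cdf_above_right_cont: "continuous (at_right a) (cdf_above x)"
proof -
  have "(cdf_above x \<longlongrightarrow> cdf_above x a) (at_right a)"
  proof (rule tendsto_sandwich)
    show "((\<lambda>t. cdf_above x a) \<longlongrightarrow> cdf_above x a) (at_right a)" by simp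
    show "((\<lambda>t. cdf_above x a + (cdf \<nu> t - cdf \<nu> a)) \<longlongrightarrow> cdf_above x a) (at_right a)"
      using \<nu>.cdf_is_right_cont[of a]
      by (auto intro!: tendsto_eq_intros simp: continuous_within)
    show "\<forall>\<^sub>F t in at_right a. cdf_above x a \<le> cdf_above x t"
      by (auto simp: eventually_at_filter cdf_above_mono)
    show "\<forall>\<^sub>F t in at_right a. cdf_above x t \<le> cdf_above x a + (cdf \<nu> t - cdf \<nu> a)"
    proof -
      have "cdf_above x t \<le> cdf_above x a + (cdf \<nu> t - cdf \<nu> a)" if "a < t" for t
        using cdf_above_increment_le[of a t x] that by simp
      then show ?thesis by (auto simp: eventually_at_filter)
    qed
  qed
  then show ?thesis by (simp add: continuous_within)
qed

lemma cdf_above_at_bot: "(cdf_above x \<longlongrightarrow> 0) at_bot"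
  by (rule tendsto_eventually) (auto simp: eventually_at_bot_linorder cdf_above_def)

text \<open>The infimum lies between \<open>0\<close> and its value at \<open>z = y\<close>, and both bounds lead to the mass of \<open>\<mu>\<close>
above \<open>x\<close>.\<close>

lemma cdf_above_at_top: "(cdf_above x \<longlongrightarrow> 1 - cdf \<mu> x) at_top"
proof (rule tendsto_sandwich)
  show "((\<lambda>y. cdf \<nu> y - cdf \<mu> x) \<longlongrightarrow> 1 - cdf \<mu> x) at_top"
    by (intro tendsto_intros \<nu>.cdf_lim_at_top_prob)
  show "((\<lambda>y. cdf \<mu> y - cdf \<mu> x) \<longlongrightarrow> 1 - cdf \<mu> x) at_top"
    by (intro tendsto_intros \<mu>.cdf_lim_at_top_prob)
  have "cdf \<nu> y - cdf \<mu> x \<le> cdf_above x y \<and> cdf_above x y \<le> cdf \<mu> y - cdf \<mu> x" if "x \<le> y" for y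
    using that min_gap_greatest[of x y 0] min_gap_le[of x y y] gap_nonneg
    by (simp add: cdf_above_eq gap_def[of y])
  then show "\<forall>\<^sub>F y in at_top. cdf \<nu> y - cdf \<mu> x \<le> cdf_above x y"
    and "\<forall>\<^sub>F y in at_top. cdf_above x y \<le> cdf \<mu> y - cdf \<mu> x"
    by (auto simp: eventually_at_top_linorder)
qed

definition least_candidate :: "real \<Rightarrow> real measure" where
  "least_candidate x = interval_measure (cdf_above x)"

lemma finite_borel_measure_least_candidate: "finite_borel_measure (least_candidate x)"
  unfolding least_candidate_def
  by (rule finite_borel_measure_interval_measure[OF cdf_above_mono cdf_above_right_cont
        cdf_above_at_bot cdf_above_at_top]) (auto simp: \<mu>.cdf_bounded_prob)

lemma cdf_least_candidate: "cdf (least_candidate x) = cdf_above x"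
  unfolding least_candidate_def
  by (rule cdf_interval_measure[OF cdf_above_mono cdf_above_right_cont cdf_above_at_bot])

lemma emeasure_least_candidate_UNIV: "emeasure (least_candidate x) UNIV = ennreal (1 - cdf \<mu> x)"
  unfolding least_candidate_def
  by (rule interval_measure_UNIV[OF cdf_above_mono cdf_above_right_cont
        cdf_above_at_bot cdf_above_at_top]) (auto simp: \<mu>.cdf_bounded_prob)

lemma least_candidate_le: "B \<in> sets borel \<Longrightarrow> emeasure (least_candidate x) B \<le> emeasure \<nu> B"
  by (rule emeasure_mono_if_cdf_increments_le)
     (auto simp: finite_borel_measure_least_candidate \<nu>.finite_borel_measure_axioms
        cdf_least_candidate cdf_above_increment_le)

lemma least_candidate_antimono:
  "x \<le> x' \<Longrightarrow> B \<in> sets borel \<Longrightarrow> emeasure (least_candidate x') B \<le> emeasure (least_candidate x) B"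
  by (rule emeasure_mono_if_cdf_increments_le)
     (auto simp: finite_borel_measure_least_candidate cdf_least_candidate cdf_above_increment_antimono)

lemma measure_restrict_above:
  assumes "A \<in> sets borel"
  shows "measure (restrict_above \<mu> x) A = measure \<mu> (A \<inter> {x<..})"
proof -
  have "emeasure (restrict_above \<mu> x) A = emeasure \<mu> ({x<..} \<inter> A)"
    unfolding restrict_above_def using assms by (intro emeasure_restricted) auto
  then show ?thesis by (simp add: measure_def Int_commute)
qed

lemma measure_greaterThan: "measure \<mu> {x<..} = 1 - cdf \<mu> x"
proof -
  have "{x<..} = space \<mu> - {..x}" by auto
  then show ?thesis unfolding cdf_def by (simp only:) (subst \<mu>.prob_compl, auto)
qed

lemma cdf_restrict_above:
  "cdf (restrict_above \<mu> x) t = (if t \<le> x then 0 else cdf \<mu> t - cdf \<mu> x)"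
proof -
  have "{..t} \<inter> {x<..} = {x<..t}" by auto
  then show ?thesis
    by (simp add: cdf_def[of "restrict_above \<mu> x"] measure_restrict_above \<mu>.cdf_diff_eq)
qed

lemma least_candidate_in_candidates: "least_candidate x \<in> candidates \<mu> \<nu> x"
proof -
  have "measure (restrict_above \<mu> x) UNIV = measure (least_candidate x) UNIV"
    using emeasure_least_candidate_UNIV[of x] \<mu>.cdf_bounded_prob[of x]
    by (simp add: measure_restrict_above measure_greaterThan measure_def[of "least_candidate x"])
  moreover have "cdf (least_candidate x) t \<le> cdf (restrict_above \<mu> x) t" for t
    using min_gap_le[of x t t]
    by (auto simp: cdf_least_candidate cdf_restrict_above cdf_above_def gap_def)
  moreover have "least_candidate x \<le> \<nu>"
    using finite_borel_measure.M_is_borel[OF finite_borel_measure_least_candidate]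
    by (subst le_measure) (auto simp: least_candidate_le)
  ultimately show ?thesis
    by (simp add: candidates_def st_le_def finite_borel_measure_least_candidate)
qed

text \<open>For \<open>x \<le> z \<le> t\<close> a candidate has at most the mass of \<open>\<mu>\<close> on \<open>(x, z]\<close> below \<open>z\<close>, and at most the
mass of \<open>\<nu>\<close> on \<open>(z, t]\<close>. Optimising over \<open>z\<close> gives exactly \<open>cdf_above x t\<close>.\<close>

lemma least_candidate_st_le:
  assumes "\<theta> \<in> candidates \<mu> \<nu> x"
  shows "least_candidate x \<preceq>\<^sub>s\<^sub>t \<theta>"
proof -
  interpret \<theta>: finite_borel_measure \<theta> using assms by (simp add: candidates_def)
  have st: "restrict_above \<mu> x \<preceq>\<^sub>s\<^sub>t \<theta>" and le: "\<theta> \<le> \<nu>"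
    using assms by (auto simp: candidates_def)
  have "cdf \<theta> t \<le> cdf_above x t" for t
  proof (cases "t \<le> x")
    case True
    then show ?thesis
      using st by (auto simp: st_le_def cdf_restrict_above cdf_above_def dest!: spec[of _ t])
  next
    case False
    have "cdf \<theta> t + cdf \<mu> x - cdf \<nu> t \<le> min_gap x t"
    proof (rule min_gap_greatest)
      fix z assume z: "x \<le> z" "z \<le> t"
      have "emeasure \<theta> {z<..t} \<le> emeasure \<nu> {z<..t}"
        using le \<theta>.M_is_borel by (subst (asm) le_measure) auto
      then have "cdf \<theta> t - cdf \<theta> z \<le> cdf \<nu> t - cdf \<nu> z"
        using z by (simp add: \<theta>.emeasure_Ioc \<nu>.emeasure_Ioc \<nu>.cdf_nondecreasing)
      moreover have "cdf \<theta> z \<le> cdf \<mu> z - cdf \<mu> x"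
        using st z by (auto simp: st_le_def cdf_restrict_above split: if_splits dest!: spec[of _ z])
      ultimately show "cdf \<theta> t + cdf \<mu> x - cdf \<nu> t \<le> gap z" by (simp add: gap_def)
    qed (use False in simp)
    then show ?thesis using False by (simp add: cdf_above_def)
  qed
  moreover have "measure (least_candidate x) UNIV = measure \<theta> UNIV"
    using st least_candidate_in_candidates[of x] by (simp add: st_le_def candidates_def)
  ultimately show ?thesis by (simp add: st_le_def cdf_least_candidate)
qed

text \<open>Since a least element exists, it is the only minimal one, so the definite description in
\<open>nu_above\<close> denotes it.\<close>

lemma st_minimal_iff: "st_minimal (candidates \<mu> \<nu> x) \<theta> \<longleftrightarrow> \<theta> = least_candidate x"
proof
  assume "st_minimal (candidates \<mu> \<nu> x) \<theta>"
  then show "\<theta> = least_candidate x"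
    using least_candidate_in_candidates[of x] least_candidate_st_le[of \<theta> x] by (auto simp: st_minimal_def)
next
  assume \<theta>: "\<theta> = least_candidate x"
  have "\<theta>' = least_candidate x" if "\<theta>' \<in> candidates \<mu> \<nu> x" "\<theta>' \<preceq>\<^sub>s\<^sub>t least_candidate x" for \<theta>'
  proof (rule cdf_unique')
    show "finite_borel_measure \<theta>'" using that by (simp add: candidates_def)
    show "cdf \<theta>' = cdf (least_candidate x)"
      using least_candidate_st_le[OF that(1)] that(2) by (auto simp: st_le_def intro!: ext antisym)
  qed (rule finite_borel_measure_least_candidate)
  then show "st_minimal (candidates \<mu> \<nu> x) \<theta>"
    by (simp add: \<theta> st_minimal_def least_candidate_in_candidates)
qed

lemma nu_above_eq: "nu_above \<mu> \<nu> x = least_candidate x"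
  by (simp add: nu_above_def st_minimal_iff)

section \<open>Existence and uniqueness of the optimal coupling\<close>

lemma ex_optimal_directional_coupling: "\<exists>P. is_optimal_directional_coupling \<mu> \<nu> P"
proof -
  obtain P where P: "prob_space P" and sets_P: "sets P = sets borel" and snd_P: "distr P borel snd = \<nu>"
    and rect: "\<And>x B. B \<in> sets borel \<Longrightarrow> emeasure P ({x<..} \<times> B) = emeasure (least_candidate x) B"
    using coupling_from_decreasing_submeasures[OF \<mu>.real_distribution_axioms \<nu>.real_distribution_axioms,
        of least_candidate] finite_borel_measure.M_is_borel[OF finite_borel_measure_least_candidate]
      least_candidate_le least_candidate_antimono emeasure_least_candidate_UNIV
    by blast
  interpret P: prob_space P by fact
  have space_P: "space P = UNIV" using sets_eq_imp_space_eq[OF sets_P] by simp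
  have fst_meas[measurable]: "fst \<in> borel_measurable P"
    by (subst measurable_cong_sets[OF sets_P refl]) (simp add: borel_prod[symmetric])
  have rect_sets[measurable]: "A \<in> sets borel \<Longrightarrow> B \<in> sets borel \<Longrightarrow> A \<times> B \<in> sets P" for A B :: "real set"
    unfolding sets_P borel_prod[symmetric] by simp
  have "distr P borel fst = \<mu>"
  proof (rule cdf_unique)
    show "real_distribution (distr P borel fst)" by simp
    have "measure P (fst -` {..x}) = cdf \<mu> x" for x
    proof -
      have "measure P ({x<..} \<times> UNIV) = 1 - cdf \<mu> x"
        using rect[of UNIV x] emeasure_least_candidate_UNIV[of x] \<mu>.cdf_bounded_prob[of x]
        by (simp add: measure_def)
      moreover have "fst -` {..x} = space P - {x<..} \<times> UNIV" by (auto simp: space_P)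
      ultimately show ?thesis by (simp add: P.prob_compl)
    qed
    then show "cdf (distr P borel fst) = cdf \<mu>"
      by (auto simp: cdf_def2[of "distr P borel fst"] measure_distr space_P)
  qed (rule \<mu>.real_distribution_axioms)
  moreover have "AE w in P. w \<in> halfplane"
  proof -
    have null: "{q<..} \<times> {..q} \<in> null_sets P" for q
    proof -
      have "emeasure P ({q<..} \<times> {..q}) = emeasure (least_candidate q) {..q}" by (simp add: rect)
      also have "\<dots> = ennreal (cdf (least_candidate q) q)"
        using finite_borel_measure_least_candidate[of q]
        by (simp add: cdf_def finite_borel_measure_def finite_measure.emeasure_eq_measure)
      also have "\<dots> = 0" by (simp add: cdf_least_candidate cdf_above_def)
      finally show ?thesis by (simp add: null_sets_def)
    qed
    \<comment> \<open>The open half-plane below the diagonal is covered by countably many such quadrants.\<close>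
    have "AE w in P. \<forall>q\<in>\<rat>. w \<notin> {q<..} \<times> {..q}"
      by (subst AE_ball_countable[OF countable_rat]) (auto intro: AE_not_in null)
    then show ?thesis
    proof eventually_elim
      fix w :: "real \<times> real" assume w: "\<forall>q\<in>\<rat>. w \<notin> {q<..} \<times> {..q}"
      show "w \<in> halfplane"
      proof (rule ccontr)
        assume "w \<notin> halfplane"
        then have "snd w < fst w" by (auto simp: halfplane_def)
        then obtain q where "q \<in> \<rat>" "snd w < q" "q < fst w" using Rats_dense_in_real by blast
        then show False using w by (cases w) auto
      qed
    qed
  qed
  ultimately have "directional_coupling \<mu> \<nu> P"
    using P sets_P snd_P by (simp add: directional_coupling_def)
  then show ?thesis
    using rect by (auto simp: is_optimal_directional_coupling_def nu_above_eq)
qed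

lemma is_optimal_directional_coupling_unique:
  assumes "is_optimal_directional_coupling \<mu> \<nu> P" and "is_optimal_directional_coupling \<mu> \<nu> Q"
  shows "P = Q"
  using assms by (intro measure_eqI_upper_quadrants)
    (simp_all add: is_optimal_directional_coupling_def directional_coupling_def)

lemma optimal_directional_coupling_is_optimal:
  "is_optimal_directional_coupling \<mu> \<nu> (optimal_directional_coupling \<mu> \<nu>)"
  unfolding optimal_directional_coupling_def
  using ex_optimal_directional_coupling is_optimal_directional_coupling_unique by (metis theI)

section \<open>The joint distribution function\<close>

text \<open>The lower left quadrant is what remains of the strip \<open>\<real> \<times> (-\<infinity>, y]\<close>, of mass \<open>F\<^sub>\<nu> y\<close>, when the part above \<open>x\<close>
is removed.\<close>

lemma joint_cdf_optimal_directional_coupling: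
  "joint_cdf (optimal_directional_coupling \<mu> \<nu>) x y = cdf \<nu> y - cdf_above x y"
proof -
  define P where "P = optimal_directional_coupling \<mu> \<nu>"
  have P: "is_optimal_directional_coupling \<mu> \<nu> P"
    unfolding P_def by (rule optimal_directional_coupling_is_optimal)
  then interpret P: prob_space P
    by (simp add: is_optimal_directional_coupling_def directional_coupling_def)
  have sets_P: "sets P = sets borel" and snd_P: "distr P borel snd = \<nu>"
    using P by (simp_all add: is_optimal_directional_coupling_def directional_coupling_def)
  have space_P: "space P = UNIV" using sets_eq_imp_space_eq[OF sets_P] by simp
  have rect_sets: "A \<in> sets borel \<Longrightarrow> B \<in> sets borel \<Longrightarrow> A \<times> B \<in> sets P" for A B :: "real set"
    unfolding sets_P borel_prod[symmetric] by simp
  have snd_meas: "snd \<in> borel_measurable P"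
    by (subst measurable_cong_sets[OF sets_P refl]) (simp add: borel_prod[symmetric])
  have above: "measure P ({x<..} \<times> {..y}) = cdf_above x y"
    using P by (simp add: is_optimal_directional_coupling_def nu_above_eq measure_def cdf_def
        flip: cdf_least_candidate)
  have "cdf \<nu> y = measure P (snd -` {..y})"
    using measure_distr[OF snd_meas, of "{..y}"] by (simp add: snd_P cdf_def2 space_P)
  also have "snd -` {..y} = {..x} \<times> {..y} \<union> {x<..} \<times> {..y}" by auto
  also have "measure P \<dots> = measure P ({..x} \<times> {..y}) + measure P ({x<..} \<times> {..y})"
    by (rule P.finite_measure_Union) (auto intro: rect_sets)
  finally show ?thesis
    by (simp add: joint_cdf_def above flip: P_def)
qed

end

theorem corollary2p4:
  fixes \<mu> \<nu> :: "real measure" and x y :: real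
  assumes "real_distribution \<mu>" and "real_distribution \<nu>"
    and "\<mu> \<preceq>\<^sub>s\<^sub>t \<nu>"
  shows "joint_cdf (optimal_directional_coupling \<mu> \<nu>) x y =
    (if y \<le> x then cdf \<nu> y
     else cdf \<mu> x - (INF z\<in>{x..y}. cdf \<mu> z - cdf \<nu> z))"
proof -
  interpret st_ordered \<mu> \<nu>
    using assms by (simp add: st_ordered_def st_ordered_axioms_def)
  show ?thesis
    by (simp add: joint_cdf_optimal_directional_coupling cdf_above_def min_gap_def gap_def)
qed

end
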